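(* Suppose that for every $i\in[m]$ the function $f_i$ is gradient Lipschitz continuous with constant $r_i>0$, and let $\{(\mathbf{y}^k,X^k,\Pi^k)\}$ be the sequence generated by the ICEADMM algorithm with $H_i=\Theta_i$ and $\sigma_i>3\sqrt2\,w_ir_i$ for every $i\in[m]$. Suppose that the level set $\mathcal{S}(\varphi^1)$ is bounded and that $f$ is convex. Then: (i) The sequences $\{\mathcal{L}^k\}$, $\{F(X^k)\}$ and $\{f(\mathbf{y}^k)\}$ converge to the optimal function value of problem (P): $$\lim_{k\to\infty}\mathcal{L}^k=\lim_{k\to\infty}F(X^k)=\lim_{k\to\infty}f(\mathbf{y}^k)=f^*.$$ (ii) Any accumulation point $(\mathbf{y}^\infty,X^\infty,\Pi^\infty)$ of $\{(\mathbf{y}^k,X^k,\Pi^k)\}$ is an optimal solution to (P'), and $\mathbf{y}^\infty$ is an optimal solution to (P). (iii) If, in addition, $f$ is strongly convex, then the whole sequence $\{(\mathbf{y}^k,X^k,\Pi^k)\}$ converges to the unique optimal solution $(\mathbf{x}^*,X^*,\Pi^* )$ to (P'), where $\mathbf{x}^*$ is the unique optimal solution to (P).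
   Context: Setting. $m,n\ge 1$ are integers, $[m]=\{1,\dots,m\}$, $w_1,\dots,w_m>0$ with $\sum_i w_i=1$, and each $f_i:\mathbb{R}^n\to\mathbb{R}$ is bounded from below. $f(\mathbf{x}):=\sum_{i=1}^m w_if_i(\mathbf{x})$. Problem (P): $\min_{\mathbf{x}\in\mathbb{R}^n} f(\mathbf{x})$, with minimizer $\mathbf{x}^*$ and optimal value $f^*:=f(\mathbf{x}^* )>-\infty$. Problem (P'): $\min_{\mathbf{x},\mathbf{x}_1,\dots,\mathbf{x}_m\in\mathbb{R}^n}\sum_{i=1}^m w_if_i(\mathbf{x}_i)$ subject to $\mathbf{x}_i=\mathbf{x}$, $i\in[m]$. A function $g$ is gradient Lipschitz continuous with constant $r$ if it is differentiable and $\|\nabla g(\mathbf{x})-\nabla g(\mathbf{z})\|\le r\|\mathbf{x}-\mathbf{z}\|$ for all $\mathbf{x},\mathbf{z}$ (Euclidean norm). $\Theta_i$ is a symmetric $n\times n$ matrix with $r_iI\succeq\Theta_i\succeq0$ such that $f_i(\mathbf{x})\le f_i(\mathbf{z})+\langle\nabla f_i(\mathbf{z}),\mathbf{x}-\mathbf{z}\rangle+\frac12\langle\Theta_i(\mathbf{x}-\mathbf{z}),\mathbf{x}-\mathbf{z}\rangle$ for all $\mathbf{x},\mathbf{z}\in\mathbb{R}^n$ (such a matrix exists, e.g. $\Theta_i=r_iI$). A triple $(\mathbf{x},X,\Pi)$, $X=(\mathbf{x}_1,\dots,\mathbf{x}_m)$, $\Pi=(\boldsymbol{\pi}_1,\dots,\boldsymbol{\pi}_m)$,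 is called an optimal solution to (P') if $(\mathbf{x},X)$ solves (P') and $\Pi$ is a corresponding Lagrange multiplier, i.e. $w_i\nabla f_i(\mathbf{x}_i)+\boldsymbol{\pi}_i=0$ and $\mathbf{x}_i=\mathbf{x}$ for all $i\in[m]$, and $\sum_{i=1}^m\boldsymbol{\pi}_i=0$. ICEADMM algorithm. Parameters $\sigma_i>0$, symmetric $H_i\succeq0$ ($i\in[m]$), $\sigma:=\sum_i\sigma_i$, an integer $k_0>0$, initial points $\mathbf{x}_i^0,\boldsymbol{\pi}_i^0\in\mathbb{R}^n$ ($i\in[m]$). Put $\mathcal{K}=\{0,k_0,2k_0,\dots\}$ and $\tau_k=\lfloor k/k_0\rfloor k_0$. For $k=0,1,2,\dots$: if $k\in\mathcal{K}$, set $\mathbf{x}^{k+1}=\sum_{i=1}^m\frac{\sigma_i}{\sigma}\mathbf{x}_i^k+\frac1\sigma\sum_{i=1}^m\boldsymbol{\pi}_i^k$. Then, with $\mathbf{y}^{k+1}:=\mathbf{x}^{\tau_k+1}$, for each $i\in[m]$ set $\mathbf{x}_i^{k+1}=\mathbf{x}_i^k-(w_iH_i+\sigma_iI)^{-1}\big[\sigma_i(\mathbf{x}_i^k-\mathbf{y}^{k+1})+w_i\nabla f_i(\mathbf{x}_i^k)+\boldsymbol{\pi}_i^k\big]$ and $\boldsymbol{\pi}_i^{k+1}=\boldsymbol{\pi}_i^k+\sigma_i(\mathbf{x}_i^{k+1}-\mathbf{y}^{k+1})$. Write $X^k=(\mathbf{x}_1^k,\dots,\mathbf{x}_m^k)$,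 $\Pi^k=(\boldsymbol{\pi}_1^k,\dots,\boldsymbol{\pi}_m^k)$. Notation. For $k\ge1$, $\mathcal{L}^k:=\sum_{i=1}^m\big(w_if_i(\mathbf{x}_i^k)+\langle\mathbf{x}_i^k-\mathbf{y}^k,\boldsymbol{\pi}_i^k\rangle+\frac{\sigma_i}{2}\|\mathbf{x}_i^k-\mathbf{y}^k\|^2\big)$ and $\varphi^k:=\mathcal{L}^k+\sum_{i=1}^m\frac{6w_i^2r_i^2}{\sigma_i}\|\mathbf{x}_i^k-\mathbf{x}_i^{k-1}\|^2$. $F(X):=\sum_{i=1}^m w_if_i(\mathbf{x}_i)$. $\mathcal{S}(\alpha):=\{\mathbf{x}\in\mathbb{R}^n: f(\mathbf{x})\le\alpha\}$. *)

theory Defs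
  imports "HOL-Analysis.Analysis"
begin

text \<open>
  The dimension n is the cardinality of the index type 'n and the index set [m] is the finite
  type 'm.  Tuples of m vectors, such as \<open>X\<close> and \<open>\<pi>\<close>, have type \<open>(real^'n)^'m\<close>.
\<close>

definition grad :: "('a::real_inner \<Rightarrow> real) \<Rightarrow> 'a \<Rightarrow> 'a" where
  "grad g x = (THE D. GDERIV g x :> D)"

definition gradient_lipschitz :: "real \<Rightarrow> ('a::real_inner \<Rightarrow> real) \<Rightarrow> bool" where
  "gradient_lipschitz r g \<longleftrightarrow>
     (\<forall>x. g differentiable (at x)) \<and>
     (\<forall>x z. norm (grad g x - grad g z) \<le> r * norm (x - z))"

definition strongly_convex :: "('a::real_inner \<Rightarrow> real) \<Rightarrow> bool" where
  "strongly_convex g \<longleftrightarrow>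
     (\<exists>\<mu>>0. \<forall>x z. \<forall>t\<in>{0..1}.
        g (t *\<^sub>R x + (1 - t) *\<^sub>R z)
          \<le> t * g x + (1 - t) * g z - \<mu> / 2 * t * (1 - t) * (norm (x - z))\<^sup>2)"

definition psd :: "real^'n^'n \<Rightarrow> bool" where
  "psd A \<longleftrightarrow> transpose A = A \<and> (\<forall>v. 0 \<le> (A *v v) \<bullet> v)"

definition loewner_le :: "real^'n^'n \<Rightarrow> real^'n^'n \<Rightarrow> bool" where
  "loewner_le A B \<longleftrightarrow> psd (B - A)"

definition quadratic_majorizer :: "real^'n^'n \<Rightarrow> (real^'n \<Rightarrow> real) \<Rightarrow> bool" where
  "quadratic_majorizer \<Theta> g \<longleftrightarrow>
     (\<forall>x z. g x \<le> g z + grad g z \<bullet> (x - z) + 1/2 * ((\<Theta> *v (x - z)) \<bullet> (x - z)))"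

definition objective :: "('m::finite \<Rightarrow> real) \<Rightarrow> ('m \<Rightarrow> real^'n \<Rightarrow> real) \<Rightarrow> real^'n \<Rightarrow> real" where
  "objective w f x = (\<Sum>i\<in>UNIV. w i * f i x)"

definition split_objective ::
    "('m::finite \<Rightarrow> real) \<Rightarrow> ('m \<Rightarrow> real^'n \<Rightarrow> real) \<Rightarrow> (real^'n)^'m \<Rightarrow> real" where
  "split_objective w f X = (\<Sum>i\<in>UNIV. w i * f i (X $ i))"

definition solves_P ::
    "('m::finite \<Rightarrow> real) \<Rightarrow> ('m \<Rightarrow> real^'n \<Rightarrow> real) \<Rightarrow> real^'n \<Rightarrow> bool" where
  "solves_P w f x \<longleftrightarrow> (\<forall>z. objective w f x \<le> objective w f z)"

definition solves_P' ::
    "('m::finite \<Rightarrow> real) \<Rightarrow> ('m \<Rightarrow> real^'n \<Rightarrow> real) \<Rightarrow> real^'n \<Rightarrow> (real^'n)^'m \<Rightarrow> bool" where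
  "solves_P' w f x X \<longleftrightarrow>
     (\<forall>i. X $ i = x) \<and>
     (\<forall>z Z. (\<forall>i. Z $ i = z) \<longrightarrow> split_objective w f X \<le> split_objective w f Z)"

definition optimal_triple ::
    "('m::finite \<Rightarrow> real) \<Rightarrow> ('m \<Rightarrow> real^'n \<Rightarrow> real) \<Rightarrow>
     (real^'n) \<times> ((real^'n)^'m) \<times> ((real^'n)^'m) \<Rightarrow> bool" where
  "optimal_triple w f = (\<lambda>(x, X, \<pi>).
     solves_P' w f x X \<and>
     (\<forall>i. w i *\<^sub>R grad (f i) (X $ i) + \<pi> $ i = 0 \<and> X $ i = x) \<and>
     (\<Sum>i\<in>UNIV. \<pi> $ i) = 0)"

definition tau :: "nat \<Rightarrow> nat \<Rightarrow> nat" where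
  "tau k0 k = (k div k0) * k0"

text \<open>
  The sequences \<open>x\<close>, \<open>y\<close>, \<open>X\<close>, \<open>\<pi>\<close> form a run of ICEADMM.  The initial points \<open>X 0\<close> and \<open>\<pi> 0\<close>
  are arbitrary.  The values \<open>x (k + 1)\<close> with \<open>k0\<close> not dividing \<open>k\<close>, and \<open>x 0\<close>, \<open>y 0\<close>, are not
  assigned by the algorithm and influence nothing else; they are left unconstrained.
\<close>

definition ICEADMM ::
    "('m::finite \<Rightarrow> real) \<Rightarrow> ('m \<Rightarrow> real^'n \<Rightarrow> real) \<Rightarrow> ('m \<Rightarrow> real) \<Rightarrow> ('m \<Rightarrow> real^'n^'n) \<Rightarrow> nat \<Rightarrow>
     (nat \<Rightarrow> real^'n) \<Rightarrow> (nat \<Rightarrow> real^'n) \<Rightarrow> (nat \<Rightarrow> (real^'n)^'m) \<Rightarrow> (nat \<Rightarrow> (real^'n)^'m) \<Rightarrow> bool" where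
  "ICEADMM w f \<sigma> H k0 x y X \<pi> \<longleftrightarrow>
     (\<forall>i. 0 < \<sigma> i) \<and> (\<forall>i. psd (H i)) \<and> 0 < k0 \<and>
     (\<forall>k. k0 dvd k \<longrightarrow>
        x (k + 1) = (\<Sum>i\<in>UNIV. (\<sigma> i / sum \<sigma> UNIV) *\<^sub>R (X k $ i))
                  + (1 / sum \<sigma> UNIV) *\<^sub>R (\<Sum>i\<in>UNIV. \<pi> k $ i)) \<and>
     (\<forall>k. y (k + 1) = x (tau k0 k + 1)) \<and>
     (\<forall>k i. X (k + 1) $ i = X k $ i
        - matrix_inv (w i *\<^sub>R H i + \<sigma> i *\<^sub>R mat 1)
            *v (\<sigma> i *\<^sub>R (X k $ i - y (k + 1)) + w i *\<^sub>R grad (f i) (X k $ i) + \<pi> k $ i)) \<and>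
     (\<forall>k i. \<pi> (k + 1) $ i = \<pi> k $ i + \<sigma> i *\<^sub>R (X (k + 1) $ i - y (k + 1)))"

text \<open>The two quantities below are meaningful for \<open>k \<ge> 1\<close> only.\<close>

definition aug_lagrangian ::
    "('m::finite \<Rightarrow> real) \<Rightarrow> ('m \<Rightarrow> real^'n \<Rightarrow> real) \<Rightarrow> ('m \<Rightarrow> real) \<Rightarrow>
     (nat \<Rightarrow> real^'n) \<Rightarrow> (nat \<Rightarrow> (real^'n)^'m) \<Rightarrow> (nat \<Rightarrow> (real^'n)^'m) \<Rightarrow> nat \<Rightarrow> real" where
  "aug_lagrangian w f \<sigma> y X \<pi> k =
     (\<Sum>i\<in>UNIV. w i * f i (X k $ i) + (X k $ i - y k) \<bullet> (\<pi> k $ i)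
                 + \<sigma> i / 2 * (norm (X k $ i - y k))\<^sup>2)"

definition merit ::
    "('m::finite \<Rightarrow> real) \<Rightarrow> ('m \<Rightarrow> real^'n \<Rightarrow> real) \<Rightarrow> ('m \<Rightarrow> real) \<Rightarrow> ('m \<Rightarrow> real) \<Rightarrow>
     (nat \<Rightarrow> real^'n) \<Rightarrow> (nat \<Rightarrow> (real^'n)^'m) \<Rightarrow> (nat \<Rightarrow> (real^'n)^'m) \<Rightarrow> nat \<Rightarrow> real" where
  "merit w f \<sigma> r y X \<pi> k =
     aug_lagrangian w f \<sigma> y X \<pi> k
     + (\<Sum>i\<in>UNIV. 6 * (w i)\<^sup>2 * (r i)\<^sup>2 / \<sigma> i * (norm (X k $ i - X (k - 1) $ i))\<^sup>2)"

definition level_set :: "('a \<Rightarrow> real) \<Rightarrow> real \<Rightarrow> 'a set" where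
  "level_set g \<alpha> = {x. g x \<le> \<alpha>}"

definition accumulation_point :: "(nat \<Rightarrow> 'a::topological_space) \<Rightarrow> 'a \<Rightarrow> bool" where
  "accumulation_point s l \<longleftrightarrow> (\<exists>\<phi>::nat \<Rightarrow> nat. strict_mono \<phi> \<and> (s \<circ> \<phi>) \<longlonglongrightarrow> l)"

end

theory Submission
  imports Defs
begin

text \<open>
  Since the \<open>X\<close>-update minimizes a quadratic model exactly, the multiplier equals
  \<open>- w i *\<^sub>R grad (f i) (X k $ i)\<close> up to \<open>\<Theta> i\<close> applied to the last step.  Hence dual
  increments are controlled by two consecutive primal steps, and for \<open>\<sigma> i > 3 * sqrt 2 * w i * r i\<close>
  the merit function decreases by a positive multiple of the squared steps while dominating the
  objective at \<open>y k\<close>.  So \<open>y\<close> stays in a bounded level set, all steps and consensus gaps vanish, and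
  the sum of the multipliers tends to 0 because it does so at the aggregation times.  Therefore the
  gradient of the objective at \<open>y k\<close> tends to 0, and convexity bounds the optimality gap by this
  gradient times the distance to the minimizer.
\<close>

section \<open>Matrix bounds and vanishing sequences\<close>

lemma psd_norm_le:
  fixes A :: "real^'n^'n"
  assumes "psd A" "loewner_le A (r *\<^sub>R mat 1)" "r > 0"
  shows "norm (A *v v) \<le> r * norm v"
proof -
  have upper: "(A *v u) \<bullet> u \<le> r * (u \<bullet> u)" for u
    using assms(2) unfolding loewner_le_def psd_def
    by (simp add: matrix_vector_mult_diff_rdistrib scaleR_matrix_vector_assoc[symmetric] inner_diff_left)
  have sym: "(A *v u) \<bullet> v = u \<bullet> (A *v v)" for u v
    using assms(1) by (metis psd_def dot_lmul_matrix transpose_matrix_vector)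
  \<comment> \<open>Expand the quadratic form of \<open>A\<close> at a gradient step of length \<open>1/r\<close> from \<open>v\<close>.\<close>
  define a where "a = A *v v"
  have "0 \<le> (A *v (v - (1/r) *\<^sub>R a)) \<bullet> (v - (1/r) *\<^sub>R a)"
    using assms(1) by (simp add: psd_def)
  also have "\<dots> = a \<bullet> v - 2 / r * (a \<bullet> a) + (1/r)\<^sup>2 * ((A *v a) \<bullet> a)"
    using sym[of a v]
    by (simp add: a_def matrix_vector_mult_diff_distrib matrix_vector_mult_scaleR
        inner_simps algebra_simps power2_eq_square)
  also have "\<dots> \<le> a \<bullet> v - 2 / r * (a \<bullet> a) + (1/r)\<^sup>2 * (r * (a \<bullet> a))"
    using upper by (intro add_left_mono mult_left_mono) auto
  also have "\<dots> = a \<bullet> v - (a \<bullet> a) / r"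
    using assms(3) by (simp add: field_simps power2_eq_square)
  \<comment> \<open>As quadratic forms this says that \<open>A\<close> squared is at most
    \<open>r\<close> times \<open>A\<close>. Using \<open>upper\<close> a second time bounds that by
    \<open>r\<close> squared times the identity, without any spectral theory.\<close>
  finally have "a \<bullet> a \<le> r * (a \<bullet> v)"
    using assms(3) by (simp add: field_simps)
  also have "\<dots> \<le> r * (r * (v \<bullet> v))"
    using upper[of v] assms(3) by (simp add: a_def)
  finally have "(norm a)\<^sup>2 \<le> (r * norm v)\<^sup>2"
    by (simp add: power2_norm_eq_inner power_mult_distrib) (simp add: power2_eq_square mult.assoc)
  then show ?thesis
    using assms(3) power2_le_imp_le by (fastforce simp: a_def)
qed

text \<open>The shift makes the matrix positive definite, so its kernel is trivial and
  \<open>matrix_inv\<close> is a true inverse. This lets the \<open>X\<close>-update be read as a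
  linear system.\<close>

lemma psd_shift_matrix_inv:
  fixes A :: "real^'n^'n"
  assumes "psd A" "w \<ge> 0" "s > 0"
  shows "(w *\<^sub>R A + s *\<^sub>R mat 1) *v (matrix_inv (w *\<^sub>R A + s *\<^sub>R mat 1) *v b) = b"
proof -
  let ?M = "w *\<^sub>R A + s *\<^sub>R mat 1"
  have "v = 0" if "?M *v v = 0" for v
  proof -
    have "0 = (?M *v v) \<bullet> v"
      using that by simp
    also have "\<dots> = w * ((A *v v) \<bullet> v) + s * (v \<bullet> v)"
      by (simp add: matrix_vector_mult_add_rdistrib scaleR_matrix_vector_assoc[symmetric] inner_simps)
    finally have "s * (v \<bullet> v) = - (w * ((A *v v) \<bullet> v))"
      by simp
    moreover have "0 \<le> w * ((A *v v) \<bullet> v)"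
      using assms(1,2) by (simp add: psd_def)
    ultimately have "s * (v \<bullet> v) \<le> 0"
      by linarith
    then show ?thesis
      using assms(3) by (metis inner_gt_zero_iff mult_pos_pos not_le)
  qed
  then have "invertible ?M"
    by (simp add: invertible_left_inverse matrix_left_invertible_ker)
  then have "?M ** matrix_inv ?M = mat 1"
    unfolding invertible_def matrix_inv_def by (rule someI2_ex) simp
  then show ?thesis
    by (metis matrix_vector_mul_assoc matrix_vector_mul_lid)
qed

text \<open>The defect is a sum of three squares. The factor 3 is the source of the constants 6, 9
  and 18 in the descent argument.\<close>

lemma power2_norm_diff_diff_le:
  fixes a b c :: "'a::real_inner"
  shows "(norm (a + b - c))\<^sup>2 \<le> 3 * ((norm a)\<^sup>2 + (norm b)\<^sup>2 + (norm c)\<^sup>2)"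
proof -
  have "3 * ((norm a)\<^sup>2 + (norm b)\<^sup>2 + (norm c)\<^sup>2) - (norm (a + b - c))\<^sup>2
      = (norm (a - b))\<^sup>2 + (norm (a + c))\<^sup>2 + (norm (b + c))\<^sup>2"
    by (simp add: power2_norm_eq_inner inner_simps inner_commute)
  moreover have "0 \<le> (norm (a - b))\<^sup>2 + (norm (a + c))\<^sup>2 + (norm (b + c))\<^sup>2"
    by simp
  ultimately show ?thesis
    by linarith
qed

text \<open>For a fixed offset \<open>q\<close>, the value at \<open>k div k0 * k0 + q\<close> is a
  value at a multiple of \<open>k0\<close> plus \<open>q\<close> vanishing increments. Only the
  \<open>k0\<close> offsets below \<open>k0\<close> occur as \<open>k mod k0\<close>, so the finite
  sum over them dominates the sequence.\<close>

lemma tendsto_0_from_multiples: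
  fixes s :: "nat \<Rightarrow> 'a::real_normed_vector"
  assumes "k0 > 0" and incr: "(\<lambda>k. s (Suc k) - s k) \<longlonglongrightarrow> 0"
    and mult: "(\<lambda>j. s (j * k0)) \<longlonglongrightarrow> 0"
  shows "s \<longlonglongrightarrow> 0"
proof -
  have div_lim: "filterlim (\<lambda>k. k div k0) at_top sequentially"
    unfolding filterlim_at_top
  proof
    fix Z
    show "\<forall>\<^sub>F k in sequentially. Z \<le> k div k0"
      using eventually_ge_at_top[of "Z * k0"]
      by eventually_elim (simp add: assms(1) less_eq_div_iff_mult_less_eq)
  qed
  have tau_lim: "filterlim (\<lambda>k. k div k0 * k0 + q) at_top sequentially" for q
  proof (rule filterlim_at_top_mono[OF div_lim])
    show "\<forall>\<^sub>F k in sequentially. k div k0 \<le> k div k0 * k0 + q"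
      using assms(1) by (simp add: trans_le_add1)
  qed
  have "(\<lambda>k. s (k div k0 * k0 + q)) \<longlonglongrightarrow> 0" for q
  proof (induction q)
    case 0
    then show ?case
      using filterlim_compose[OF mult div_lim] by simp
  next
    case (Suc q)
    from tendsto_add[OF Suc filterlim_compose[OF incr tau_lim[of q]]]
    show ?case
      by simp
  qed
  then have sum_lim: "(\<lambda>k. \<Sum>q<k0. norm (s (k div k0 * k0 + q))) \<longlonglongrightarrow> 0"
    by (intro tendsto_null_sum tendsto_norm_zero)
  show ?thesis
  proof (rule Lim_null_comparison[OF always_eventually sum_lim], rule allI)
    fix k
    have "norm (s (k div k0 * k0 + k mod k0)) \<le> (\<Sum>q<k0. norm (s (k div k0 * k0 + q)))"
      using assms(1) by (intro member_le_sum) auto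
    then show "norm (s k) \<le> (\<Sum>q<k0. norm (s (k div k0 * k0 + q)))"
      by simp
  qed
qed

lemma tendsto_0_if_norm_sq:
  assumes "((\<lambda>k. (norm (s k))\<^sup>2) \<longlongrightarrow> 0) F"
  shows "(s \<longlongrightarrow> 0) F"
proof -
  have "((\<lambda>k. norm (s k)) \<longlongrightarrow> 0) F"
    using tendsto_real_sqrt[OF assms] by simp
  then show ?thesis
    by (rule tendsto_norm_zero_cancel)
qed

section \<open>Optimality conditions and quadratic growth\<close>

text \<open>The first component determines the other two, so uniqueness of the optimal triple
  reduces to uniqueness of the minimizer.\<close>

lemma optimal_triple_iff:
  "optimal_triple w f (x, X, p) \<longleftrightarrow>
     solves_P w f x \<and> X = (\<chi> i. x) \<and> p = (\<chi> i. - (w i *\<^sub>R grad (f i) x)) \<and>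
     (\<Sum>i\<in>UNIV. w i *\<^sub>R grad (f i) x) = 0"
proof -
  have "solves_P' w f x (\<chi> i. x) \<longleftrightarrow> solves_P w f x"
  proof
    assume "solves_P' w f x (\<chi> i. x)"
    then have "split_objective w f (\<chi> i. x) \<le> split_objective w f (\<chi> i. z)" for z
      by (simp add: solves_P'_def)
    then show "solves_P w f x"
      by (simp add: solves_P_def objective_def split_objective_def)
  qed (simp add: solves_P_def solves_P'_def objective_def split_objective_def)
  moreover have "(\<forall>i. X $ i = x) \<longleftrightarrow> X = (\<chi> i. x)"
    by (simp add: vec_eq_iff)
  moreover have "(\<forall>i. w i *\<^sub>R grad (f i) x + p $ i = 0) \<longleftrightarrow> p = (\<chi> i. - (w i *\<^sub>R grad (f i) x))"
    by (auto simp: vec_eq_iff add_eq_0_iff)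
  moreover have "(\<Sum>i\<in>UNIV. - (w i *\<^sub>R grad (f i) x)) = - (\<Sum>i\<in>UNIV. w i *\<^sub>R grad (f i) x)"
    by (rule sum_negf)
  ultimately show ?thesis
    unfolding optimal_triple_def by auto
qed

text \<open>Strong convexity at the midpoint of \<open>z\<close> and \<open>c\<close>, where the
  value is at least \<open>g c\<close>, gives quadratic growth around the minimizer. Convergence of
  values thereby becomes convergence of points.\<close>

lemma strongly_convex_minimizer_gap:
  assumes "strongly_convex g" and "\<And>z. g c \<le> g z"
  obtains C where "\<And>z. (norm (z - c))\<^sup>2 \<le> C * (g z - g c)"
proof -
  from assms(1) obtain \<mu> where mu: "\<mu> > 0" and "\<And>x z t. t \<in> {0..1} \<Longrightarrow>
      g (t *\<^sub>R x + (1 - t) *\<^sub>R z) \<le> t * g x + (1 - t) * g z - \<mu> / 2 * t * (1 - t) * (norm (x - z))\<^sup>2"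
    unfolding strongly_convex_def by blast
  from this(2)[of "1/2" _ c]
  have half: "g c \<le> 1/2 * g z + 1/2 * g c - \<mu> / 8 * (norm (z - c))\<^sup>2" for z
    using assms(2) order_trans by fastforce
  have "(norm (z - c))\<^sup>2 \<le> 4 / \<mu> * (g z - g c)" for z
    using half[of z] mu by (simp add: field_simps)
  then show thesis
    by (rule that)
qed

section \<open>Standing assumptions and smoothness estimates\<close>

locale iceadmm =
  fixes w r \<sigma> :: "'m::finite \<Rightarrow> real"
    and f :: "'m \<Rightarrow> real^'n \<Rightarrow> real"
    and \<Theta> :: "'m \<Rightarrow> real^'n^'n"
    and k0 :: nat
    and x y :: "nat \<Rightarrow> real^'n"
    and X \<pi> :: "nat \<Rightarrow> (real^'n)^'m"
    and xstar :: "real^'n"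
  assumes w_pos: "w i > 0"
    and minimizer: "solves_P w f xstar"
    and r_pos: "r i > 0"
    and grad_lipschitz: "gradient_lipschitz (r i) (f i)"
    and Theta_psd: "psd (\<Theta> i)"
    and Theta_le: "loewner_le (\<Theta> i) (r i *\<^sub>R mat 1)"
    and Theta_majorizer: "quadratic_majorizer (\<Theta> i) (f i)"
    and sigma_gt: "\<sigma> i > 3 * sqrt 2 * w i * r i"
    and run: "ICEADMM w f \<sigma> \<Theta> k0 x y X \<pi>"
begin

lemma sigma_pos: "\<sigma> i > 0"
  and k0_pos: "k0 > 0"
  using run by (auto simp: ICEADMM_def)

text \<open>The parameter threshold in the form that makes \<open>decr\<close> positive.\<close>

lemma sigma_sq: "18 * (w i)\<^sup>2 * (r i)\<^sup>2 < (\<sigma> i)\<^sup>2"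
proof -
  have "(3 * sqrt 2 * w i * r i)\<^sup>2 < (\<sigma> i)\<^sup>2"
    using sigma_gt[of i] w_pos[of i] r_pos[of i] by (intro power_strict_mono) auto
  then show ?thesis
    by (simp add: power_mult_distrib)
qed

text \<open>A cruder linear form of the threshold, with \<open>sqrt 2\<close> rounded down to 1, for
  absorbing curvature into the penalty in \<open>objective_le_merit\<close>.\<close>

lemma sigma_ge: "3 * (w i * r i) \<le> \<sigma> i"
proof -
  have "3 * (w i * r i) * 1 \<le> 3 * (w i * r i) * sqrt 2"
    using w_pos[of i] r_pos[of i] by (intro mult_left_mono) auto
  also have "\<dots> \<le> \<sigma> i"
    using sigma_gt[of i] by (simp add: mult_ac)
  finally show ?thesis
    by simp
qed

lemma grad_lip: "norm (grad (f i) u - grad (f i) v) \<le> r i * norm (u - v)"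
  using grad_lipschitz by (simp add: gradient_lipschitz_def)

lemma isCont_grad: "isCont (grad (f i)) u"
proof -
  have "(r i)-lipschitz_on UNIV (grad (f i))"
    using grad_lip r_pos[of i] by (intro lipschitz_onI) (auto simp: dist_norm)
  then show ?thesis
    using lipschitz_on_continuous_on continuous_on_eq_continuous_at by blast
qed

lemma isCont_f: "isCont (f i) u"
  using grad_lipschitz[of i]
  by (intro differentiable_imp_continuous_within) (simp add: gradient_lipschitz_def)

lemma isCont_objective: "isCont (objective w f) u"
  unfolding objective_def by (intro continuous_intros isCont_f)

lemma norm_Theta: "norm (\<Theta> i *v v) \<le> r i * norm v"
  using psd_norm_le Theta_psd Theta_le r_pos by blast

lemma f_upper: "f i u \<le> f i v + grad (f i) v \<bullet> (u - v) + r i / 2 * (norm (u - v))\<^sup>2"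
proof -
  have "(\<Theta> i *v (u - v)) \<bullet> (u - v) \<le> norm (\<Theta> i *v (u - v)) * norm (u - v)"
    by (rule norm_cauchy_schwarz)
  also have "\<dots> \<le> r i * norm (u - v) * norm (u - v)"
    using norm_Theta by (intro mult_right_mono) auto
  finally have "(\<Theta> i *v (u - v)) \<bullet> (u - v) \<le> r i * (norm (u - v))\<^sup>2"
    by (simp add: power2_eq_square)
  then show ?thesis
    using Theta_majorizer[of i, unfolded quadratic_majorizer_def, rule_format, of u v] by simp
qed

text \<open>Exchange the two points in \<open>f_upper\<close>, then move the gradient from
  \<open>u\<close> to \<open>v\<close> by the Lipschitz bound. The constant 3/2 is 1/2 from the
  model plus 1 from this exchange; no convexity of the summand enters.\<close>

lemma f_lower: "f i v + grad (f i) v \<bullet> (u - v) - 3 / 2 * r i * (norm (u - v))\<^sup>2 \<le> f i u"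
proof -
  have "(grad (f i) u - grad (f i) v) \<bullet> (v - u) \<le> norm (grad (f i) u - grad (f i) v) * norm (v - u)"
    by (rule norm_cauchy_schwarz)
  also have "\<dots> \<le> r i * norm (u - v) * norm (v - u)"
    using grad_lip by (intro mult_right_mono) auto
  also have "\<dots> = r i * (norm (u - v))\<^sup>2"
    by (simp add: power2_eq_square norm_minus_commute)
  finally show ?thesis
    using f_upper[of i v u] by (simp add: inner_diff norm_minus_commute field_simps)
qed

section \<open>Update identities and multiplier estimates\<close>

definition dX :: "nat \<Rightarrow> 'm \<Rightarrow> real^'n" where
  "dX k i = X (Suc k) $ i - X k $ i"

definition gap :: "nat \<Rightarrow> 'm \<Rightarrow> real^'n" where
  "gap k i = X k $ i - y k"

text \<open>The stationarity condition of the quadratic model. The shift term in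
  \<open>dX k i\<close> moves the penalty from the old to the new point, which is why the gap has
  index \<open>Suc k\<close>.\<close>

lemma X_step:
  "w i *\<^sub>R (\<Theta> i *v dX k i) + \<sigma> i *\<^sub>R gap (Suc k) i + w i *\<^sub>R grad (f i) (X k $ i) + \<pi> k $ i = 0"
proof -
  let ?M = "w i *\<^sub>R \<Theta> i + \<sigma> i *\<^sub>R mat 1"
  let ?b = "\<sigma> i *\<^sub>R (X k $ i - y (Suc k)) + w i *\<^sub>R grad (f i) (X k $ i) + \<pi> k $ i"
  have "dX k i = - (matrix_inv ?M *v ?b)"
    using run by (simp add: dX_def ICEADMM_def)
  then have "?M *v dX k i = - ?b"
    using psd_shift_matrix_inv[OF Theta_psd[of i] less_imp_le[OF w_pos[of i]] sigma_pos[of i], of ?b]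
    by (simp add: vec.neg)
  then have "w i *\<^sub>R (\<Theta> i *v dX k i) + \<sigma> i *\<^sub>R dX k i = - ?b"
    by (simp add: matrix_vector_mult_add_rdistrib scaleR_matrix_vector_assoc[symmetric])
  then show ?thesis
    by (simp add: dX_def gap_def algebra_simps add_eq_0_iff)
qed

lemma dual_step: "\<pi> (Suc k) $ i = \<pi> k $ i + \<sigma> i *\<^sub>R gap (Suc k) i"
  using run by (simp add: ICEADMM_def gap_def)

text \<open>The dual update adds precisely the penalty term of \<open>X_step\<close>.\<close>

lemma dual_eq: "\<pi> (Suc k) $ i = - (w i *\<^sub>R grad (f i) (X k $ i)) - w i *\<^sub>R (\<Theta> i *v dX k i)"
proof -
  have "\<pi> (Suc k) $ i + (w i *\<^sub>R grad (f i) (X k $ i) + w i *\<^sub>R (\<Theta> i *v dX k i)) = 0"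
    using X_step[of i k] unfolding dual_step by (simp add: ac_simps)
  then show ?thesis
    by (simp add: add_eq_0_iff2)
qed

text \<open>The multiplier carries the gradient at the previous point. Moving it to the new point
  and discarding the \<open>\<Theta> i\<close> term each cost \<open>w i * r i\<close> times the
  step.\<close>

lemma stationarity_residual:
  "norm (\<pi> (Suc k) $ i + w i *\<^sub>R grad (f i) (X (Suc k) $ i)) \<le> 2 * w i * r i * norm (dX k i)"
proof -
  have "\<pi> (Suc k) $ i + w i *\<^sub>R grad (f i) (X (Suc k) $ i)
      = w i *\<^sub>R ((grad (f i) (X (Suc k) $ i) - grad (f i) (X k $ i)) - \<Theta> i *v dX k i)"
    by (simp add: dual_eq algebra_simps)
  also have "norm \<dots> \<le> w i * (r i * norm (dX k i) + r i * norm (dX k i))"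
    using w_pos[of i] grad_lip[of i "X (Suc k) $ i" "X k $ i"] norm_Theta[of i "dX k i"]
      norm_triangle_ineq4[of "grad (f i) (X (Suc k) $ i) - grad (f i) (X k $ i)" "\<Theta> i *v dX k i"]
    unfolding dX_def by simp
  finally show ?thesis
    by (simp add: mult_ac)
qed

text \<open>Apply \<open>dual_eq\<close> at two consecutive indices, hence the shift past the
  arbitrary initial multiplier. The older step has weight 2: it enters through the gradient
  difference and through \<open>\<Theta> i\<close>.\<close>

lemma dual_increment:
  "(norm (\<pi> (Suc (Suc k)) $ i - \<pi> (Suc k) $ i))\<^sup>2
     \<le> 3 * (w i)\<^sup>2 * (r i)\<^sup>2 * ((norm (dX (Suc k) i))\<^sup>2 + 2 * (norm (dX k i))\<^sup>2)"
proof -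
  let ?a = "grad (f i) (X (Suc k) $ i) - grad (f i) (X k $ i)"
  let ?b = "\<Theta> i *v dX (Suc k) i" and ?c = "\<Theta> i *v dX k i"
  have "\<pi> (Suc (Suc k)) $ i - \<pi> (Suc k) $ i = - (w i *\<^sub>R (?a + ?b - ?c))"
    by (simp add: dual_eq algebra_simps)
  then have "(norm (\<pi> (Suc (Suc k)) $ i - \<pi> (Suc k) $ i))\<^sup>2 = (w i)\<^sup>2 * (norm (?a + ?b - ?c))\<^sup>2"
    by (simp add: power_mult_distrib)
  also have "\<dots> \<le> (w i)\<^sup>2 * (3 * ((norm ?a)\<^sup>2 + (norm ?b)\<^sup>2 + (norm ?c)\<^sup>2))"
    by (intro mult_left_mono power2_norm_diff_diff_le) auto
  also have "\<dots> \<le> (w i)\<^sup>2 * (3 * ((r i * norm (dX k i))\<^sup>2 + (r i * norm (dX (Suc k) i))\<^sup>2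
      + (r i * norm (dX k i))\<^sup>2))"
    using grad_lip norm_Theta by (intro mult_left_mono add_mono power_mono) (auto simp: dX_def)
  finally show ?thesis
    by (simp add: power_mult_distrib algebra_simps)
qed

section \<open>Descent of the merit function\<close>

text \<open>One summand of the augmented Lagrangian with its three arguments free, so that the
  effects of the \<open>y\<close>, \<open>X\<close> and multiplier updates can be separated.\<close>

definition lag :: "'m \<Rightarrow> real^'n \<Rightarrow> real^'n \<Rightarrow> real^'n \<Rightarrow> real" where
  "lag i v u p = w i * f i u + (u - v) \<bullet> p + \<sigma> i / 2 * (norm (u - v))\<^sup>2"

lemma aug_lagrangian_eq: "aug_lagrangian w f \<sigma> y X \<pi> k = (\<Sum>i\<in>UNIV. lag i (y k) (X k $ i) (\<pi> k $ i))"
  by (simp add: aug_lagrangian_def lag_def)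

lemma sum_sigma_pos: "sum \<sigma> UNIV > 0"
  using sigma_pos by (intro sum_pos) auto

text \<open>The first-order condition saying that the aggregated point minimizes the sum of the
  \<open>lag\<close> terms in their consensus argument.\<close>

lemma y_balance:
  assumes "k0 dvd k"
  shows "(\<Sum>i\<in>UNIV. \<pi> k $ i + \<sigma> i *\<^sub>R (X k $ i - y (Suc k))) = 0"
proof -
  have "y (Suc k) = (\<Sum>i\<in>UNIV. (\<sigma> i / sum \<sigma> UNIV) *\<^sub>R (X k $ i))
                  + (1 / sum \<sigma> UNIV) *\<^sub>R (\<Sum>i\<in>UNIV. \<pi> k $ i)"
    using run assms by (simp add: ICEADMM_def tau_def)
  then have "sum \<sigma> UNIV *\<^sub>R y (Suc k) = (\<Sum>i\<in>UNIV. \<sigma> i *\<^sub>R (X k $ i)) + (\<Sum>i\<in>UNIV. \<pi> k $ i)"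
    using sum_sigma_pos by (simp add: scaleR_add_right scaleR_sum_right)
  then show ?thesis
    by (simp add: scaleR_diff_right sum.distrib sum_subtractf scaleR_sum_left)
qed

lemma y_unchanged:
  assumes "\<not> k0 dvd Suc k"
  shows "y (Suc (Suc k)) = y (Suc k)"
proof -
  have "Suc k div k0 = k div k0"
    using assms by (simp add: div_Suc dvd_eq_mod_eq_0)
  then show ?thesis
    using run by (simp add: ICEADMM_def tau_def)
qed

text \<open>At aggregation times the new \<open>y\<close> minimizes a convex quadratic; at all other
  times \<open>y\<close> does not move.\<close>

lemma lag_y_step:
  "(\<Sum>i\<in>UNIV. lag i (y (Suc (Suc k))) (X (Suc k) $ i) (\<pi> (Suc k) $ i))
     \<le> (\<Sum>i\<in>UNIV. lag i (y (Suc k)) (X (Suc k) $ i) (\<pi> (Suc k) $ i))"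
proof (cases "k0 dvd Suc k")
  case True
  let ?u = "y (Suc (Suc k))" and ?v = "y (Suc k)"
  have "lag i ?u (X (Suc k) $ i) (\<pi> (Suc k) $ i)
        + (?u - ?v) \<bullet> (\<pi> (Suc k) $ i + \<sigma> i *\<^sub>R (X (Suc k) $ i - ?u))
      \<le> lag i ?v (X (Suc k) $ i) (\<pi> (Suc k) $ i)" for i
  proof -
    \<comment> \<open>Exact expansion around the new point. The linear terms cancel only after
      summation over \<open>i\<close>, by \<open>y_balance\<close>.\<close>
    have "lag i ?v (X (Suc k) $ i) (\<pi> (Suc k) $ i) = lag i ?u (X (Suc k) $ i) (\<pi> (Suc k) $ i)
        + (?u - ?v) \<bullet> (\<pi> (Suc k) $ i + \<sigma> i *\<^sub>R (X (Suc k) $ i - ?u))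
        + \<sigma> i / 2 * (norm (?u - ?v))\<^sup>2"
      unfolding lag_def power2_norm_eq_inner
      by (simp add: inner_simps inner_commute field_simps)
    then show ?thesis
      using sigma_pos[of i] by (simp add: zero_le_mult_iff)
  qed
  then have "(\<Sum>i\<in>UNIV. lag i ?u (X (Suc k) $ i) (\<pi> (Suc k) $ i)
        + (?u - ?v) \<bullet> (\<pi> (Suc k) $ i + \<sigma> i *\<^sub>R (X (Suc k) $ i - ?u)))
      \<le> (\<Sum>i\<in>UNIV. lag i ?v (X (Suc k) $ i) (\<pi> (Suc k) $ i))"
    by (rule sum_mono)
  then show ?thesis
    using y_balance[OF True] by (simp add: sum.distrib inner_sum_right[symmetric])
qed (simp add: y_unchanged)

text \<open>The primal move gains half of \<open>\<sigma> i\<close> times the squared step, and the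
  multiplier move then loses its squared length over \<open>\<sigma> i\<close>.\<close>

lemma lag_X_dual_step:
  "lag i (y (Suc k)) (X (Suc k) $ i) (\<pi> (Suc k) $ i)
     \<le> lag i (y (Suc k)) (X k $ i) (\<pi> k $ i) - \<sigma> i / 2 * (norm (dX k i))\<^sup>2
       + (norm (\<pi> (Suc k) $ i - \<pi> k $ i))\<^sup>2 / \<sigma> i"
proof -
  let ?x = "X k $ i" and ?x' = "X (Suc k) $ i" and ?T = "\<Theta> i *v dX k i" and ?g = "grad (f i) (X k $ i)"
  have "w i * f i ?x' \<le> w i * (f i ?x + ?g \<bullet> dX k i + 1/2 * (?T \<bullet> dX k i))"
    using Theta_majorizer[of i] w_pos[of i]
    by (intro mult_left_mono) (auto simp: quadratic_majorizer_def dX_def)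
  moreover have "(?x' - y (Suc k)) \<bullet> \<pi> (Suc k) $ i
      = (?x' - y (Suc k)) \<bullet> \<pi> k $ i + (norm (\<pi> (Suc k) $ i - \<pi> k $ i))\<^sup>2 / \<sigma> i"
    using sigma_pos[of i] unfolding dual_step power2_norm_eq_inner gap_def
    by (simp add: inner_simps field_simps)
  moreover have "\<sigma> i / 2 * (norm (?x' - y (Suc k)))\<^sup>2 = \<sigma> i / 2 * (norm (?x - y (Suc k)))\<^sup>2
      + (\<sigma> i *\<^sub>R gap (Suc k) i) \<bullet> dX k i - \<sigma> i / 2 * (norm (dX k i))\<^sup>2"
    unfolding dX_def gap_def power2_norm_eq_inner
    by (simp add: inner_simps inner_commute field_simps)
  \<comment> \<open>Testing \<open>X_step\<close> against the step cancels all first-order terms.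
    What remains of the majorizer is minus half its quadratic form, which may be dropped by positive
    semidefiniteness.\<close>
  moreover have "(w i *\<^sub>R ?T + \<sigma> i *\<^sub>R gap (Suc k) i + w i *\<^sub>R ?g + \<pi> k $ i) \<bullet> dX k i = 0"
    by (simp add: X_step)
  moreover have "(?x' - y (Suc k)) \<bullet> \<pi> k $ i = (?x - y (Suc k)) \<bullet> \<pi> k $ i + \<pi> k $ i \<bullet> dX k i"
    by (simp add: dX_def inner_simps inner_commute)
  moreover have "0 \<le> w i * (?T \<bullet> dX k i)"
    using Theta_psd[of i] w_pos[of i] by (simp add: psd_def)
  ultimately show ?thesis
    unfolding lag_def by (simp add: inner_add_left algebra_simps)
qed

abbreviation "\<phi> \<equiv> merit w f \<sigma> r y X \<pi>"

text \<open>Indexing by \<open>Suc k\<close> removes the truncated subtraction in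
  \<open>merit\<close> and stays clear of the unassigned \<open>y 0\<close>.\<close>

lemma merit_Suc:
  "\<phi> (Suc k) = aug_lagrangian w f \<sigma> y X \<pi> (Suc k)
     + (\<Sum>i\<in>UNIV. 6 * (w i)\<^sup>2 * (r i)\<^sup>2 / \<sigma> i * (norm (dX k i))\<^sup>2)"
  by (simp add: merit_def dX_def)

text \<open>The primal gain \<open>\<sigma> i / 2\<close> minus the coefficient 9, which is 3 from
  the newer step in \<open>dual_increment\<close> plus 6 reserved in the merit function for the next
  iteration.\<close>

definition decr :: "'m \<Rightarrow> real" where
  "decr i = \<sigma> i / 2 - 9 * (w i)\<^sup>2 * (r i)\<^sup>2 / \<sigma> i"

lemma decr_pos: "decr i > 0"
  using sigma_sq[of i] sigma_pos[of i] by (simp add: decr_def field_simps power2_eq_square)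

text \<open>The extra term of the merit function pays for the share of the older step in the dual
  increment; its coefficient 6 is the 3 times 2 of \<open>dual_increment\<close>.\<close>

lemma merit_descent:
  "\<phi> (Suc (Suc k)) + (\<Sum>i\<in>UNIV. decr i * (norm (dX (Suc k) i))\<^sup>2) \<le> \<phi> (Suc k)"
proof -
  let ?l = "\<lambda>i. lag i (y (Suc (Suc k))) (X (Suc k) $ i) (\<pi> (Suc k) $ i)"
  let ?b = "\<lambda>i. 6 * (w i)\<^sup>2 * (r i)\<^sup>2 / \<sigma> i"
  have "lag i (y (Suc (Suc k))) (X (Suc (Suc k)) $ i) (\<pi> (Suc (Suc k)) $ i)
        + ?b i * (norm (dX (Suc k) i))\<^sup>2 + decr i * (norm (dX (Suc k) i))\<^sup>2
      \<le> ?l i + ?b i * (norm (dX k i))\<^sup>2" for i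
  proof -
    have "(norm (\<pi> (Suc (Suc k)) $ i - \<pi> (Suc k) $ i))\<^sup>2 / \<sigma> i
        \<le> 3 * (w i)\<^sup>2 * (r i)\<^sup>2 * ((norm (dX (Suc k) i))\<^sup>2 + 2 * (norm (dX k i))\<^sup>2) / \<sigma> i"
      using dual_increment sigma_pos[of i] by (intro divide_right_mono) auto
    with lag_X_dual_step[of i "Suc k"] show ?thesis
      by (simp add: decr_def add_divide_distrib algebra_simps)
  qed
  then have "(\<Sum>i\<in>UNIV. lag i (y (Suc (Suc k))) (X (Suc (Suc k)) $ i) (\<pi> (Suc (Suc k)) $ i)
        + ?b i * (norm (dX (Suc k) i))\<^sup>2 + decr i * (norm (dX (Suc k) i))\<^sup>2)
      \<le> (\<Sum>i\<in>UNIV. ?l i + ?b i * (norm (dX k i))\<^sup>2)"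
    by (rule sum_mono)
  then show ?thesis
    using lag_y_step[of k] by (simp add: merit_Suc aug_lagrangian_eq sum.distrib)
qed

section \<open>Lower bound on the merit function and vanishing steps\<close>

text \<open>Compare each summand at \<open>X (Suc k) $ i\<close> and at \<open>y (Suc k)\<close> by
  \<open>f_upper\<close>. The multiplier nearly cancels the linear term, and the error is shared
  between the merit correction and the penalty.\<close>

lemma objective_le_merit: "objective w f (y (Suc k)) \<le> \<phi> (Suc k)"
proof -
  have "w i * f i (y (Suc k)) \<le> lag i (y (Suc k)) (X (Suc k) $ i) (\<pi> (Suc k) $ i)
      + 6 * (w i)\<^sup>2 * (r i)\<^sup>2 / \<sigma> i * (norm (dX k i))\<^sup>2" for i
  proof -
    let ?e = "gap (Suc k) i" and ?g = "grad (f i) (X (Suc k) $ i)" and ?p = "\<pi> (Suc k) $ i"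
    define a b where "a = norm (dX k i)" and "b = norm ?e"
    have "w i * f i (y (Suc k)) \<le> w i * (f i (X (Suc k) $ i) - ?g \<bullet> ?e + r i / 2 * b\<^sup>2)"
      using f_upper[of i "y (Suc k)" "X (Suc k) $ i"] w_pos[of i]
      by (simp add: gap_def b_def norm_minus_commute inner_diff_right)
    moreover have "- ((?p + w i *\<^sub>R ?g) \<bullet> ?e) \<le> 2 * w i * r i * a * b"
    proof -
      have "- ((?p + w i *\<^sub>R ?g) \<bullet> ?e) \<le> norm (?p + w i *\<^sub>R ?g) * norm ?e"
        by (metis abs_le_iff Cauchy_Schwarz_ineq2)
      also have "\<dots> \<le> 2 * w i * r i * a * b"
        using stationarity_residual unfolding a_def b_def by (intro mult_right_mono) auto
      finally show ?thesis .
    qed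
    \<comment> \<open>Young's inequality, weighted so that the \<open>a\<close> part is exactly the
      merit correction.\<close>
    moreover have "2 * w i * r i * a * b \<le> 6 * (w i)\<^sup>2 * (r i)\<^sup>2 / \<sigma> i * a\<^sup>2 + \<sigma> i / 6 * b\<^sup>2"
    proof -
      have "0 \<le> (6 * w i * r i * a - \<sigma> i * b)\<^sup>2 / (6 * \<sigma> i)"
        using sigma_pos[of i] by simp
      also have "\<dots> = 6 * (w i)\<^sup>2 * (r i)\<^sup>2 / \<sigma> i * a\<^sup>2 + \<sigma> i / 6 * b\<^sup>2 - 2 * w i * r i * a * b"
        using sigma_pos[of i] by (simp add: field_simps power2_eq_square)
      finally show ?thesis
        by simp
    qed
    \<comment> \<open>Together with the \<open>\<sigma> i / 6\<close> spent above,
      \<open>\<sigma> i / 3\<close> uses up the penalty coefficient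
      \<open>\<sigma> i / 2\<close>.\<close>
    moreover have "w i * r i / 2 * b\<^sup>2 \<le> \<sigma> i / 3 * b\<^sup>2"
      using sigma_ge[of i] sigma_pos[of i] by (intro mult_right_mono) auto
    ultimately show ?thesis
      unfolding lag_def by (simp add: gap_def[symmetric] b_def a_def inner_simps inner_commute algebra_simps)
  qed
  then have "(\<Sum>i\<in>UNIV. w i * f i (y (Suc k))) \<le> (\<Sum>i\<in>UNIV. lag i (y (Suc k)) (X (Suc k) $ i) (\<pi> (Suc k) $ i)
      + 6 * (w i)\<^sup>2 * (r i)\<^sup>2 / \<sigma> i * (norm (dX k i))\<^sup>2)"
    by (rule sum_mono)
  then show ?thesis
    by (simp add: objective_def merit_Suc aug_lagrangian_eq sum.distrib)
qed

lemma decr_sum_nonneg: "0 \<le> (\<Sum>i\<in>UNIV. decr i * (norm (dX k i))\<^sup>2)"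
  using decr_pos by (intro sum_nonneg mult_nonneg_nonneg) (auto simp: less_imp_le)

lemma decseq_merit: "decseq (\<lambda>k. \<phi> (Suc k))"
proof (rule decseq_SucI)
  show "\<phi> (Suc (Suc k)) \<le> \<phi> (Suc k)" for k
    using merit_descent[of k] decr_sum_nonneg[of "Suc k"] by linarith
qed

text \<open>The merit values decrease and are bounded below by the optimal value, so their
  consecutive differences, which dominate the squared steps, vanish.\<close>

lemma dX_tendsto: "(\<lambda>k. dX k i) \<longlonglongrightarrow> 0"
proof -
  have "\<forall>k. objective w f xstar \<le> \<phi> (Suc k)"
    using minimizer objective_le_merit order_trans unfolding solves_P_def by blast
  then obtain L where L: "(\<lambda>k. \<phi> (Suc k)) \<longlonglongrightarrow> L"
    using decseq_merit decseq_convergent by blast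
  then have "(\<lambda>k. \<phi> (Suc k) - \<phi> (Suc (Suc k))) \<longlonglongrightarrow> L - L"
    by (intro tendsto_diff LIMSEQ_Suc[OF L])
  then have lim: "(\<lambda>k. (\<phi> (Suc k) - \<phi> (Suc (Suc k))) / decr i) \<longlonglongrightarrow> 0"
    by (auto intro: tendsto_divide_zero)
  have "(norm (dX (Suc k) i))\<^sup>2 \<le> (\<phi> (Suc k) - \<phi> (Suc (Suc k))) / decr i" for k
  proof -
    have "decr i * (norm (dX (Suc k) i))\<^sup>2 \<le> (\<Sum>i\<in>UNIV. decr i * (norm (dX (Suc k) i))\<^sup>2)"
      using decr_pos by (intro member_le_sum) (auto simp: less_imp_le)
    then show ?thesis
      using merit_descent[of k] decr_pos[of i] by (simp add: field_simps)
  qed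
  then have "(\<lambda>k. (norm (dX (Suc k) i))\<^sup>2) \<longlonglongrightarrow> 0"
    by (intro Lim_null_comparison[OF always_eventually lim]) auto
  then have "(\<lambda>k. dX (Suc k) i) \<longlonglongrightarrow> 0"
    by (rule tendsto_0_if_norm_sq)
  then show ?thesis
    by (rule LIMSEQ_imp_Suc)
qed

lemma dual_increment_tendsto: "(\<lambda>k. \<pi> (Suc k) $ i - \<pi> k $ i) \<longlonglongrightarrow> 0"
proof (rule LIMSEQ_imp_Suc, rule tendsto_0_if_norm_sq)
  have lim: "(\<lambda>k. 3 * (w i)\<^sup>2 * (r i)\<^sup>2 * ((norm (dX (Suc k) i))\<^sup>2 + 2 * (norm (dX k i))\<^sup>2)) \<longlonglongrightarrow> 0"
    by (rule tendsto_eq_intros dX_tendsto[THEN LIMSEQ_Suc] dX_tendsto refl)+ simp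
  show "(\<lambda>k. (norm (\<pi> (Suc (Suc k)) $ i - \<pi> (Suc k) $ i))\<^sup>2) \<longlonglongrightarrow> 0"
    using dual_increment by (intro Lim_null_comparison[OF always_eventually lim]) auto
qed

lemma gap_tendsto: "(\<lambda>k. gap k i) \<longlonglongrightarrow> 0"
proof (rule LIMSEQ_imp_Suc)
  have "gap (Suc k) i = (1 / \<sigma> i) *\<^sub>R (\<pi> (Suc k) $ i - \<pi> k $ i)" for k
    using sigma_pos[of i] by (simp add: dual_step)
  then show "(\<lambda>k. gap (Suc k) i) \<longlonglongrightarrow> 0"
    using tendsto_scaleR[OF tendsto_const dual_increment_tendsto] by simp
qed

section \<open>Aggregated multipliers and the gradient at \<open>y\<close>\<close>

text \<open>At multiples of \<open>k0\<close>, \<open>y_balance\<close> expresses the sum through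
  steps and gaps, which vanish. The vanishing increments extend this to all indices.\<close>

lemma sum_dual_tendsto: "(\<lambda>k. \<Sum>i\<in>UNIV. \<pi> k $ i) \<longlonglongrightarrow> 0"
proof (rule tendsto_0_from_multiples[OF k0_pos])
  show "(\<lambda>k. (\<Sum>i\<in>UNIV. \<pi> (Suc k) $ i) - (\<Sum>i\<in>UNIV. \<pi> k $ i)) \<longlonglongrightarrow> 0"
    unfolding sum_subtractf[symmetric] by (intro tendsto_null_sum dual_increment_tendsto)
  have eq: "(\<Sum>i\<in>UNIV. \<pi> k $ i) = (\<Sum>i\<in>UNIV. \<sigma> i *\<^sub>R (dX k i - gap (Suc k) i))" if "k0 dvd k" for k
  proof -
    have "(\<Sum>i\<in>UNIV. \<pi> k $ i) - (\<Sum>i\<in>UNIV. \<sigma> i *\<^sub>R (dX k i - gap (Suc k) i))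
        = (\<Sum>i\<in>UNIV. \<pi> k $ i + \<sigma> i *\<^sub>R (X k $ i - y (Suc k)))"
      unfolding sum_subtractf[symmetric]
      by (intro sum.cong) (auto simp: dX_def gap_def algebra_simps)
    then show ?thesis
      using y_balance[OF that] by simp
  qed
  have "strict_mono (\<lambda>j. j * k0)"
    using k0_pos by (simp add: strict_mono_def)
  then have "(\<lambda>j. \<sigma> i *\<^sub>R (dX (j * k0) i - gap (Suc (j * k0)) i)) \<longlonglongrightarrow> \<sigma> i *\<^sub>R (0 - 0)" for i
    using LIMSEQ_subseq_LIMSEQ[OF dX_tendsto] LIMSEQ_subseq_LIMSEQ[OF LIMSEQ_Suc[OF gap_tendsto]]
    by (intro tendsto_intros) (auto simp: o_def)
  then have "(\<lambda>j. \<Sum>i\<in>UNIV. \<sigma> i *\<^sub>R (dX (j * k0) i - gap (Suc (j * k0)) i)) \<longlonglongrightarrow> 0"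
    by (intro tendsto_null_sum) simp
  moreover have "(\<Sum>i\<in>UNIV. \<pi> (j * k0) $ i) = (\<Sum>i\<in>UNIV. \<sigma> i *\<^sub>R (dX (j * k0) i - gap (Suc (j * k0)) i))" for j
    by (rule eq) simp
  ultimately show "(\<lambda>j. \<Sum>i\<in>UNIV. \<pi> (j * k0) $ i) \<longlonglongrightarrow> 0"
    by simp
qed

lemma residual_tendsto: "(\<lambda>k. \<pi> k $ i + w i *\<^sub>R grad (f i) (X k $ i)) \<longlonglongrightarrow> 0"
proof (rule LIMSEQ_imp_Suc)
  have lim: "(\<lambda>k. 2 * w i * r i * norm (dX k i)) \<longlonglongrightarrow> 0"
    by (intro tendsto_mult_right_zero tendsto_norm_zero dX_tendsto)
  show "(\<lambda>k. \<pi> (Suc k) $ i + w i *\<^sub>R grad (f i) (X (Suc k) $ i)) \<longlonglongrightarrow> 0"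
    using stationarity_residual by (intro Lim_null_comparison[OF always_eventually lim]) auto
qed

lemma grad_diff_tendsto: "(\<lambda>k. grad (f i) (X k $ i) - grad (f i) (y k)) \<longlonglongrightarrow> 0"
proof -
  have lim: "(\<lambda>k. r i * norm (gap k i)) \<longlonglongrightarrow> 0"
    by (intro tendsto_mult_right_zero tendsto_norm_zero gap_tendsto)
  show ?thesis
    using grad_lip by (intro Lim_null_comparison[OF always_eventually lim]) (auto simp: gap_def)
qed

text \<open>The gradient of the objective as an explicit sum, avoiding the definite description
  behind \<open>grad\<close> for the objective itself.\<close>

definition G :: "real^'n \<Rightarrow> real^'n" where
  "G u = (\<Sum>i\<in>UNIV. w i *\<^sub>R grad (f i) u)"

lemma G_y_tendsto: "(\<lambda>k. G (y k)) \<longlonglongrightarrow> 0"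
proof -
  \<comment> \<open>Insert and subtract the multipliers and the gradients at \<open>X k $ i\<close>,
    leaving three sums already known to vanish.\<close>
  have "G (y k) = (\<Sum>i\<in>UNIV. \<pi> k $ i + w i *\<^sub>R grad (f i) (X k $ i))
      - (\<Sum>i\<in>UNIV. w i *\<^sub>R (grad (f i) (X k $ i) - grad (f i) (y k))) - (\<Sum>i\<in>UNIV. \<pi> k $ i)" for k
    by (simp add: G_def sum.distrib sum_subtractf scaleR_diff_right)
  moreover have "(\<lambda>k. w i *\<^sub>R (grad (f i) (X k $ i) - grad (f i) (y k))) \<longlonglongrightarrow> 0" for i
    using tendsto_scaleR[OF tendsto_const grad_diff_tendsto] by simp
  then have "(\<lambda>k. (\<Sum>i\<in>UNIV. \<pi> k $ i + w i *\<^sub>R grad (f i) (X k $ i))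
      - (\<Sum>i\<in>UNIV. w i *\<^sub>R (grad (f i) (X k $ i) - grad (f i) (y k))) - (\<Sum>i\<in>UNIV. \<pi> k $ i))
      \<longlonglongrightarrow> 0 - 0 - 0"
    by (intro tendsto_diff tendsto_null_sum residual_tendsto sum_dual_tendsto)
  ultimately show ?thesis
    by simp
qed

end

section \<open>Convergence of values under convexity\<close>

locale convex_iceadmm = iceadmm +
  assumes level_bounded: "bounded (level_set (objective w f) (\<phi> 1))"
    and f_convex: "convex_on UNIV (objective w f)"
begin

text \<open>Monotone merit values keep every \<open>y (Suc k)\<close> in the level set of the first
  one. The shift excludes \<open>y 0\<close>, which the algorithm leaves arbitrary.\<close>

lemma y_bounded: obtains B where "\<And>k. norm (y (Suc k) - xstar) \<le> B"
proof -
  from level_bounded obtain b where b: "\<And>u. u \<in> level_set (objective w f) (\<phi> 1) \<Longrightarrow> norm u \<le> b"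
    by (auto simp: bounded_iff)
  have "norm (y (Suc k)) \<le> b" for k
  proof (rule b)
    show "y (Suc k) \<in> level_set (objective w f) (\<phi> 1)"
      using objective_le_merit[of k] decseqD[OF decseq_merit, of 0 k] by (simp add: level_set_def)
  qed
  then have "norm (y (Suc k) - xstar) \<le> b + norm xstar" for k
    by (meson add_right_mono norm_triangle_ineq4 order_trans)
  then show thesis
    by (rule that)
qed

text \<open>
  Derived from the quadratic bounds on each summand by letting the segment parameter tend to 0,
  so no derivative of the objective is ever formed.
\<close>
lemma objective_tangent: "G v \<bullet> (u - v) \<le> objective w f u - objective w f v"
proof -
  let ?d = "u - v" and ?C = "\<Sum>i\<in>UNIV. w i * (3 / 2 * r i * (norm (u - v))\<^sup>2)"
  have "G v \<bullet> ?d - ?C * t \<le> objective w f u - objective w f v" if t: "0 < t" "t \<le> 1" for t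
  proof -
    let ?z = "v + t *\<^sub>R ?d"
    have "objective w f v + t * (G v \<bullet> ?d) - ?C * t\<^sup>2
        = (\<Sum>i\<in>UNIV. w i * f i v + t * (w i * (grad (f i) v \<bullet> ?d))
            - w i * (3 / 2 * r i * (norm ?d)\<^sup>2) * t\<^sup>2)"
      by (simp add: objective_def G_def inner_sum_left sum_distrib_left sum_distrib_right sum.distrib
          sum_subtractf)
    also have "\<dots>
        = (\<Sum>i\<in>UNIV. w i * (f i v + grad (f i) v \<bullet> (?z - v) - 3 / 2 * r i * (norm (?z - v))\<^sup>2))"
      by (intro sum.cong refl) (simp add: power_mult_distrib distrib_left right_diff_distrib mult_ac)
    also have "\<dots> \<le> objective w f ?z"
      unfolding objective_def by (intro sum_mono mult_left_mono f_lower less_imp_le[OF w_pos])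
    also have "?z = (1 - t) *\<^sub>R v + t *\<^sub>R u"
      by (simp add: algebra_simps)
    also have "objective w f \<dots> \<le> (1 - t) * objective w f v + t * objective w f u"
      using t by (intro convex_onD[OF f_convex]) auto
    finally have "t * (G v \<bullet> ?d - ?C * t) \<le> t * (objective w f u - objective w f v)"
      by (simp add: algebra_simps power2_eq_square)
    then show ?thesis
      using t by simp
  qed
  then have "\<forall>\<^sub>F t in at_right 0. G v \<bullet> ?d - ?C * t \<le> objective w f u - objective w f v"
    unfolding eventually_at_right_field by (intro exI[of _ 1]) simp
  moreover have "((\<lambda>t. G v \<bullet> ?d - ?C * t) \<longlongrightarrow> G v \<bullet> ?d - ?C * 0) (at_right 0)"
    by (intro tendsto_intros)
  ultimately show ?thesis
    using tendsto_upperbound by fastforce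
qed

lemma objective_y_tendsto: "(\<lambda>k. objective w f (y k)) \<longlonglongrightarrow> objective w f xstar"
proof (rule LIMSEQ_imp_Suc, rule LIM_zero_cancel)
  obtain B where B: "\<And>k. norm (y (Suc k) - xstar) \<le> B"
    using y_bounded by blast
  have lim: "(\<lambda>k. norm (G (y (Suc k))) * B) \<longlonglongrightarrow> 0"
    by (intro tendsto_mult_left_zero tendsto_norm_zero LIMSEQ_Suc G_y_tendsto)
  have "\<bar>objective w f (y (Suc k)) - objective w f xstar\<bar> \<le> norm (G (y (Suc k))) * B" for k
  proof -
    have "objective w f (y (Suc k)) - objective w f xstar \<le> - (G (y (Suc k)) \<bullet> (xstar - y (Suc k)))"
      using objective_tangent[of "y (Suc k)" xstar] by linarith
    also have "\<dots> \<le> norm (G (y (Suc k))) * norm (y (Suc k) - xstar)"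
      by (metis inner_minus_right minus_diff_eq norm_cauchy_schwarz)
    also have "\<dots> \<le> norm (G (y (Suc k))) * B"
      by (intro mult_left_mono B) auto
    finally show ?thesis
      using minimizer by (simp add: solves_P_def)
  qed
  then show "(\<lambda>k. objective w f (y (Suc k)) - objective w f xstar) \<longlonglongrightarrow> 0"
    by (intro Lim_null_comparison[OF always_eventually lim]) auto
qed

text \<open>Lipschitz gradients are bounded along the bounded sequence \<open>y\<close>, so the
  vanishing gap decides the limit.\<close>

lemma gap_grad_tendsto: "(\<lambda>k. gap k i \<bullet> grad (f i) (y k)) \<longlonglongrightarrow> 0"
proof (rule LIMSEQ_imp_Suc)
  obtain B where B: "\<And>k. norm (y (Suc k) - xstar) \<le> B"
    using y_bounded by blast
  define M where "M = norm (grad (f i) xstar) + r i * B"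
  have "norm (grad (f i) (y (Suc k))) \<le> M" for k
    using grad_lip[of i "y (Suc k)" xstar] mult_left_mono[OF B less_imp_le[OF r_pos], of i k]
      norm_triangle_sub[of "grad (f i) (y (Suc k))" "grad (f i) xstar"]
    by (simp add: M_def)
  then have "\<bar>gap (Suc k) i \<bullet> grad (f i) (y (Suc k))\<bar> \<le> norm (gap (Suc k) i) * M" for k
    by (meson Cauchy_Schwarz_ineq2 mult_left_mono norm_ge_zero order_trans)
  moreover have lim: "(\<lambda>k. norm (gap (Suc k) i) * M) \<longlonglongrightarrow> 0"
    by (intro tendsto_mult_left_zero tendsto_norm_zero LIMSEQ_Suc gap_tendsto)
  ultimately show "(\<lambda>k. gap (Suc k) i \<bullet> grad (f i) (y (Suc k))) \<longlonglongrightarrow> 0"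
    by (intro Lim_null_comparison[OF always_eventually lim]) auto
qed

text \<open>\<open>f_upper\<close> and \<open>f_lower\<close> make the first-order remainder
  quadratic in the gap, and the linear part is \<open>gap_grad_tendsto\<close>.\<close>

lemma f_diff_tendsto: "(\<lambda>k. f i (X k $ i) - f i (y k)) \<longlonglongrightarrow> 0"
proof -
  have "\<bar>f i (X k $ i) - f i (y k) - gap k i \<bullet> grad (f i) (y k)\<bar> \<le> 3 / 2 * (r i * (norm (gap k i))\<^sup>2)" for k
  proof -
    have "0 \<le> r i * (norm (gap k i))\<^sup>2"
      using r_pos[of i] by simp
    moreover have "f i (X k $ i) \<le> f i (y k) + gap k i \<bullet> grad (f i) (y k) + r i * (norm (gap k i))\<^sup>2 / 2"
      using f_upper[of i "X k $ i" "y k"] by (simp add: gap_def inner_commute)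
    moreover have "f i (y k) + gap k i \<bullet> grad (f i) (y k) - 3 * (r i * (norm (gap k i))\<^sup>2) / 2 \<le> f i (X k $ i)"
      using f_lower[of i "y k" "X k $ i"] by (simp add: gap_def inner_commute)
    ultimately show ?thesis
      by linarith
  qed
  moreover have lim: "(\<lambda>k. 3 / 2 * (r i * (norm (gap k i))\<^sup>2)) \<longlonglongrightarrow> 0"
    by (rule tendsto_eq_intros gap_tendsto refl)+ simp
  ultimately have "(\<lambda>k. f i (X k $ i) - f i (y k) - gap k i \<bullet> grad (f i) (y k)) \<longlonglongrightarrow> 0"
    by (intro Lim_null_comparison[OF always_eventually lim]) auto
  from tendsto_add[OF this gap_grad_tendsto[of i]] show ?thesis
    by simp
qed

lemma split_objective_tendsto: "(\<lambda>k. split_objective w f (X k)) \<longlonglongrightarrow> objective w f xstar"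
proof -
  have "split_objective w f (X k)
      = objective w f (y k) + (\<Sum>i\<in>UNIV. w i * (f i (X k $ i) - f i (y k)))" for k
    by (simp add: split_objective_def objective_def algebra_simps sum_subtractf)
  moreover have "(\<lambda>k. \<Sum>i\<in>UNIV. w i * (f i (X k $ i) - f i (y k))) \<longlonglongrightarrow> 0"
    by (intro tendsto_null_sum tendsto_mult_right_zero f_diff_tendsto)
  ultimately show ?thesis
    using tendsto_add[OF objective_y_tendsto] by fastforce
qed

text \<open>The multiplier is split into the stationarity residual, a vanishing gradient difference
  and the gradient at \<open>y k\<close>. Each pairing with the gap vanishes, so no separate bound
  on the multipliers is required.\<close>

lemma gap_dual_tendsto: "(\<lambda>k. gap k i \<bullet> \<pi> k $ i) \<longlonglongrightarrow> 0"
proof -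
  have eq: "gap k i \<bullet> \<pi> k $ i = gap k i \<bullet> (\<pi> k $ i + w i *\<^sub>R grad (f i) (X k $ i))
      - w i * (gap k i \<bullet> (grad (f i) (X k $ i) - grad (f i) (y k)))
      - w i * (gap k i \<bullet> grad (f i) (y k))" for k
    by (simp add: inner_simps algebra_simps)
  have lim1: "(\<lambda>k. gap k i \<bullet> (\<pi> k $ i + w i *\<^sub>R grad (f i) (X k $ i))) \<longlonglongrightarrow> 0"
    using tendsto_inner[OF gap_tendsto residual_tendsto] by simp
  have lim2: "(\<lambda>k. w i * (gap k i \<bullet> (grad (f i) (X k $ i) - grad (f i) (y k)))) \<longlonglongrightarrow> 0"
    using tendsto_inner[OF gap_tendsto grad_diff_tendsto] by (intro tendsto_mult_right_zero) simp
  have lim3: "(\<lambda>k. w i * (gap k i \<bullet> grad (f i) (y k))) \<longlonglongrightarrow> 0"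
    by (intro tendsto_mult_right_zero gap_grad_tendsto)
  show ?thesis
    unfolding eq using tendsto_diff[OF tendsto_diff[OF lim1 lim2] lim3] by simp
qed

lemma aug_lagrangian_tendsto: "aug_lagrangian w f \<sigma> y X \<pi> \<longlonglongrightarrow> objective w f xstar"
proof -
  have eq: "aug_lagrangian w f \<sigma> y X \<pi>
      = (\<lambda>k. split_objective w f (X k) + (\<Sum>i\<in>UNIV. gap k i \<bullet> \<pi> k $ i + \<sigma> i / 2 * (norm (gap k i))\<^sup>2))"
    by (simp add: fun_eq_iff aug_lagrangian_def split_objective_def gap_def sum.distrib)
  have "(\<lambda>k. gap k i \<bullet> \<pi> k $ i + \<sigma> i / 2 * (norm (gap k i))\<^sup>2) \<longlonglongrightarrow> 0" for i
    by (rule tendsto_eq_intros gap_tendsto gap_dual_tendsto refl)+ simp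
  then have "(\<lambda>k. \<Sum>i\<in>UNIV. gap k i \<bullet> \<pi> k $ i + \<sigma> i / 2 * (norm (gap k i))\<^sup>2) \<longlonglongrightarrow> 0"
    by (intro tendsto_null_sum)
  from tendsto_add[OF split_objective_tendsto this] show ?thesis
    by (simp add: eq)
qed

section \<open>Limit points and strong convexity\<close>

text \<open>All optimality residuals vanish along the full sequence, so continuity passes them to
  the limit of any subsequence. The identity subsequence covers convergence of the whole
  sequence.\<close>

lemma limit_optimal:
  assumes sub: "strict_mono \<psi>"
    and lim: "(\<lambda>k. (y (\<psi> k), X (\<psi> k), \<pi> (\<psi> k))) \<longlonglongrightarrow> (y', X', \<pi>')"
  shows "optimal_triple w f (y', X', \<pi>')" "solves_P w f y'"
proof -
  have y': "(\<lambda>k. y (\<psi> k)) \<longlonglongrightarrow> y'"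
    using tendsto_fst[OF lim] by simp
  have X': "(\<lambda>k. X (\<psi> k) $ i) \<longlonglongrightarrow> X' $ i" for i
    using tendsto_vec_nth[OF tendsto_fst[OF tendsto_snd[OF lim]]] by simp
  have pi': "(\<lambda>k. \<pi> (\<psi> k) $ i) \<longlonglongrightarrow> \<pi>' $ i" for i
    using tendsto_vec_nth[OF tendsto_snd[OF tendsto_snd[OF lim]]] by simp
  note sub_lim = LIMSEQ_subseq_LIMSEQ[OF _ sub, unfolded o_def]
  have "objective w f y' = objective w f xstar"
    using LIMSEQ_unique[OF isCont_tendsto_compose[OF isCont_objective y'] sub_lim[OF objective_y_tendsto]] .
  then show sol: "solves_P w f y'"
    using minimizer by (simp add: solves_P_def)
  have "X' $ i - y' = 0" for i
    using LIMSEQ_unique[OF tendsto_diff[OF X' y'] sub_lim[OF gap_tendsto, unfolded gap_def]] .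
  then have X'_eq: "X' $ i = y'" for i
    by simp
  have "\<pi>' $ i + w i *\<^sub>R grad (f i) (X' $ i) = 0" for i
    by (rule LIMSEQ_unique[OF _ sub_lim[OF residual_tendsto[of i]]])
       (intro tendsto_add tendsto_scaleR tendsto_const pi' isCont_tendsto_compose[OF isCont_grad X'])
  then have pi'_eq: "\<pi>' $ i = - (w i *\<^sub>R grad (f i) y')" for i
    by (simp add: X'_eq eq_neg_iff_add_eq_0)
  have "(\<Sum>i\<in>UNIV. \<pi>' $ i) = 0"
    by (rule LIMSEQ_unique[OF tendsto_sum[OF pi'] sub_lim[OF sum_dual_tendsto]])
  then have "(\<Sum>i\<in>UNIV. w i *\<^sub>R grad (f i) y') = 0"
    by (simp add: pi'_eq sum_negf)
  with sol show "optimal_triple w f (y', X', \<pi>')"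
    by (simp add: optimal_triple_iff vec_eq_iff X'_eq pi'_eq)
qed

lemma strongly_convex_convergence:
  assumes "strongly_convex (objective w f)"
  defines "T \<equiv> (xstar, \<chi> i. xstar, \<chi> i. - (w i *\<^sub>R grad (f i) xstar))"
  shows "solves_P w f z \<longleftrightarrow> z = xstar"
    and "optimal_triple w f S \<longleftrightarrow> S = T"
    and "(\<lambda>k. (y k, X k, \<pi> k)) \<longlonglongrightarrow> T"
proof -
  have "objective w f xstar \<le> objective w f z" for z
    using minimizer by (simp add: solves_P_def)
  from strongly_convex_minimizer_gap[OF assms(1) this]
  obtain C where C: "\<And>z. (norm (z - xstar))\<^sup>2 \<le> C * (objective w f z - objective w f xstar)"
    by blast
  have unique: "solves_P w f z \<longleftrightarrow> z = xstar" for z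
  proof
    assume "solves_P w f z"
    then have "objective w f z = objective w f xstar"
      using minimizer by (simp add: solves_P_def order_antisym)
    then show "z = xstar"
      using C[of z] by simp
  qed (simp add: minimizer)
  then show "solves_P w f z \<longleftrightarrow> z = xstar" .
  \<comment> \<open>Quadratic growth turns \<open>objective_y_tendsto\<close> into convergence of
    \<open>y\<close>; the vanishing gaps and residuals then carry \<open>X\<close> and the
    multipliers along.\<close>
  have bound_lim: "(\<lambda>k. C * (objective w f (y k) - objective w f xstar)) \<longlonglongrightarrow> 0"
    by (intro tendsto_mult_right_zero LIM_zero objective_y_tendsto)
  have "(\<lambda>k. (norm (y k - xstar))\<^sup>2) \<longlonglongrightarrow> 0"
    using C by (intro Lim_null_comparison[OF always_eventually bound_lim]) simp
  then have y_lim: "y \<longlonglongrightarrow> xstar"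
    by (rule LIM_zero_cancel[OF tendsto_0_if_norm_sq])
  have X_lim: "(\<lambda>k. X k $ i) \<longlonglongrightarrow> xstar" for i
    using tendsto_add[OF y_lim gap_tendsto[of i]] by (simp add: gap_def)
  have "(\<lambda>k. (\<pi> k $ i + w i *\<^sub>R grad (f i) (X k $ i)) - w i *\<^sub>R grad (f i) (X k $ i))
      \<longlonglongrightarrow> 0 - w i *\<^sub>R grad (f i) xstar" for i
    by (intro tendsto_diff tendsto_scaleR tendsto_const residual_tendsto
        isCont_tendsto_compose[OF isCont_grad X_lim])
  then have dual_lim: "(\<lambda>k. \<pi> k $ i) \<longlonglongrightarrow> - (w i *\<^sub>R grad (f i) xstar)" for i
    by simp
  have "X \<longlonglongrightarrow> (\<chi> i. xstar)"
    by (rule vec_tendstoI) (simp add: X_lim)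
  moreover have "\<pi> \<longlonglongrightarrow> (\<chi> i. - (w i *\<^sub>R grad (f i) xstar))"
    by (rule vec_tendstoI) (simp add: dual_lim)
  ultimately show lim: "(\<lambda>k. (y k, X k, \<pi> k)) \<longlonglongrightarrow> T"
    unfolding T_def by (intro tendsto_Pair y_lim)
  \<comment> \<open>Existence of an optimal triple comes from the algorithm itself, as
    \<open>T\<close> is the limit of its run. This also supplies the vanishing gradient sum at
    \<open>xstar\<close>.\<close>
  have "optimal_triple w f T"
    using limit_optimal(1)[OF strict_mono_id] lim by (simp add: T_def)
  then show "optimal_triple w f S \<longleftrightarrow> S = T"
    by (cases S) (auto simp: T_def optimal_triple_iff unique)
qed

end

theorem corollary4p1:
  fixes w r \<sigma> :: "'m::finite \<Rightarrow> real"
    and f :: "'m \<Rightarrow> real^'n \<Rightarrow> real"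
    and \<Theta> :: "'m \<Rightarrow> real^'n^'n"
    and k0 :: nat
    and x y :: "nat \<Rightarrow> real^'n"
    and X \<pi> :: "nat \<Rightarrow> (real^'n)^'m"
    and xstar :: "real^'n"
  assumes w_pos: "\<And>i. w i > 0"
    and w_sum: "(\<Sum>i\<in>UNIV. w i) = 1"
    and f_bounded_below: "\<And>i. bdd_below (range (f i))"
    and xstar_minimizer: "solves_P w f xstar"
    and r_pos: "\<And>i. r i > 0"
    and f_grad_lipschitz: "\<And>i. gradient_lipschitz (r i) (f i)"
    and Theta_psd: "\<And>i. psd (\<Theta> i)"
    and Theta_le: "\<And>i. loewner_le (\<Theta> i) (r i *\<^sub>R mat 1)"
    and Theta_majorizer: "\<And>i. quadratic_majorizer (\<Theta> i) (f i)"
    and sigma_gt: "\<And>i. \<sigma> i > 3 * sqrt 2 * w i * r i"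
    and run: "ICEADMM w f \<sigma> \<Theta> k0 x y X \<pi>"
    and level_bounded: "bounded (level_set (objective w f) (merit w f \<sigma> r y X \<pi> 1))"
    and f_convex: "convex_on UNIV (objective w f)"
  shows
    "(aug_lagrangian w f \<sigma> y X \<pi> \<longlonglongrightarrow> objective w f xstar \<and>
      (\<lambda>k. split_objective w f (X k)) \<longlonglongrightarrow> objective w f xstar \<and>
      (\<lambda>k. objective w f (y k)) \<longlonglongrightarrow> objective w f xstar) \<and>
     (\<forall>yinf Xinf \<pi>inf.
        accumulation_point (\<lambda>k. (y k, X k, \<pi> k)) (yinf, Xinf, \<pi>inf) \<longrightarrow>
          optimal_triple w f (yinf, Xinf, \<pi>inf) \<and> solves_P w f yinf) \<and>
     (strongly_convex (objective w f) \<longrightarrow>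
        (\<forall>z. solves_P w f z \<longleftrightarrow> z = xstar) \<and>
        (\<exists>Xstar \<pi>star.
           (\<forall>T. optimal_triple w f T \<longleftrightarrow> T = (xstar, Xstar, \<pi>star)) \<and>
           (\<lambda>k. (y k, X k, \<pi> k)) \<longlonglongrightarrow> (xstar, Xstar, \<pi>star)))"
proof -
  interpret convex_iceadmm w r \<sigma> f \<Theta> k0 x y X \<pi> xstar
    by unfold_locales (rule assms)+
  have accumulation: "optimal_triple w f (y', X', \<pi>') \<and> solves_P w f y'"
    if "accumulation_point (\<lambda>k. (y k, X k, \<pi> k)) (y', X', \<pi>')" for y' X' \<pi>'
  proof -
    from that obtain \<psi> where "strict_mono \<psi>" "(\<lambda>k. (y (\<psi> k), X (\<psi> k), \<pi> (\<psi> k))) \<longlonglongrightarrow> (y', X', \<pi>')"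
      unfolding accumulation_point_def o_def by blast
    from limit_optimal[OF this] show ?thesis ..
  qed
  have strong: "\<exists>Xstar \<pi>star.
         (\<forall>T. optimal_triple w f T \<longleftrightarrow> T = (xstar, Xstar, \<pi>star)) \<and>
         (\<lambda>k. (y k, X k, \<pi> k)) \<longlonglongrightarrow> (xstar, Xstar, \<pi>star)"
    if "strongly_convex (objective w f)"
    by (intro exI conjI allI) (rule strongly_convex_convergence(2,3)[OF that])+
  show ?thesis
    by (intro conjI allI impI aug_lagrangian_tendsto split_objective_tendsto objective_y_tendsto)
       (erule accumulation[THEN conjunct1] accumulation[THEN conjunct2]
          strongly_convex_convergence(1) strong)+
qed

end
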